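(* Let $f,g,\phi$ satisfy the composite smoothness assumption, and let the saddle-subdifferential operator $M=(\nabla_u\phi+\partial f,\,-\nabla_v\phi+\partial g)$ of the problem $\min_{u}\max_{v}\{f(u)+\phi(u,v)-g(v)\}$ satisfy the weak MVI condition for some $\rho\in\big[0,\frac{1}{2L+\hat L}\big)$. Then for $\tau\in\big(\frac{\rho}{1-\rho L},\frac{1}{L+\hat L}\big)$ the sequence $\{x_k\}=\{(u_k,v_k)\}$ of the SA-MGDA method with $J=\infty$ (exact maximization oracle) satisfies, for every $k\ge1$ and every $x_*\in X_*^\rho(M)$, $$\min_{i=1,\ldots,k}\ \min_{s_i\in Mx_i}\frac{\|s_i\|^2}{2\left(\frac1\tau+L\right)}\ \le\ \min_{i=1,\ldots,k}D_h(x_i,x_{i-1})\ \le\ \frac{D_h(x_*,x_0)}{\left(1-\rho\left(\frac1\tau+L\right)\right)k}.$$ Moreover, all limit points of the sequence $\{x_k\}$ are in $X_*(M)$, and if we further assume that $X_*^\rho(M)=X_*(M)$, then the sequence $\{x_k\}$ converges to a solution $x_*\in X_*^\rho(M)$.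
   Context: Let $d=d_u+d_v$, $x=(u,v)\in\mathbb{R}^{d_u}\times\mathbb{R}^{d_v}=\mathbb{R}^d$ with Euclidean inner product and norm. Composite smoothness assumption: $f:\mathbb{R}^{d_u}\to(-\infty,\infty]$ and $g:\mathbb{R}^{d_v}\to(-\infty,\infty]$ are closed, proper and convex; $\phi:\mathbb{R}^d\to\mathbb{R}$ is continuously differentiable and there are $L_{uu},L_{uv},L_{vu},L_{vv}>0$ with $\|\nabla_u\phi(u,v)-\nabla_u\phi(\bar u,\bar v)\|\le L_{uu}\|u-\bar u\|+L_{uv}\|v-\bar v\|$ and $\|\nabla_v\phi(u,v)-\nabla_v\phi(\bar u,\bar v)\|\le L_{vu}\|u-\bar u\|+L_{vv}\|v-\bar v\|$ for all $u,\bar u,v,\bar v$. $L>0$ denotes a Lipschitz constant of $\nabla\phi$ (equivalently of $(\nabla_u\phi,-\nabla_v\phi)$) on $\mathbb{R}^d$, and $\hat L=\max\{L_{uu},L_{vv}\}$. $\operatorname{gra}M=\{(x,w):w\in Mx\}$; $X_*(M)=\{x_*:0\in Mx_*\}$ (assumed nonempty). Weak MVI condition with $\rho\ge0$: there exists $x_*\in X_*(M)$ such that $\langle x-x_*,w\rangle\ge-\frac\rho2\|w\|^2$ for all $(x,w)\in\operatorname{gra}M$. $X_*^\rho(M)$ is the set of all $x_*\in X_*(M)$ with this property. Let $h(u,v)=\frac{1}{2\tau}(\|u\|^2+\|v\|^2)-\phi(u,v)$ and $D_h(x,y)=h(x)-h(y)-\langle\nabla h(y),x-y\rangle$. SA-MGDA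 with $J=\infty$: from an initial point $x_0=(u_0,v_0)\in\mathbb{R}^d$, for $k=0,1,\dots$, $u_{k+1}=\operatorname{prox}_{\tau f}[u_k-\tau\nabla_u\phi(u_k,v_k)]$, $v_{k+1}=\operatorname{argmax}_{v\in\mathbb{R}^{d_v}}\big\{2\phi(u_{k+1},v)-\frac1{2\tau}\|v-(v_k-\tau\nabla_v\phi(u_k,v_k))\|^2-g(v)\big\}$, where $\operatorname{prox}_\psi=(I+\partial\psi)^{-1}$. Equivalently, $x_{k+1}=(\nabla h+M)^{-1}\nabla h(x_k)$, i.e. $\nabla h(x_k)-\nabla h(x_{k+1})\in Mx_{k+1}$. *)

theory Defs
  imports "HOL-Analysis.Analysis"
begin

text \<open>The Euclidean spaces of the two blocks are types of class \<open>euclidean_space\<close>; their product type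
  carries the inner product \<open>(u, v) \<bullet> (u', v') = u \<bullet> u' + v \<bullet> v'\<close> and the corresponding norm.\<close>

section \<open>Extended-valued convex functions\<close>

definition ereal_epigraph :: "('a \<Rightarrow> ereal) \<Rightarrow> ('a \<times> real) set" where
  "ereal_epigraph f = {(x, r). f x \<le> ereal r}"

definition closed_proper_convex :: "('a::euclidean_space \<Rightarrow> ereal) \<Rightarrow> bool" where
  "closed_proper_convex f \<longleftrightarrow>
     (\<forall>x. f x \<noteq> -\<infinity>) \<and> (\<exists>x. f x \<noteq> \<infinity>) \<and> convex (ereal_epigraph f) \<and> closed (ereal_epigraph f)"

text \<open>For proper \<open>f\<close> the inequality at a point of the effective domain forces \<open>f x \<noteq> \<infinity>\<close>,
  so the subdifferential is empty outside the effective domain.\<close>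

definition subdiff :: "('a::real_inner \<Rightarrow> ereal) \<Rightarrow> 'a \<Rightarrow> 'a set" where
  "subdiff f x = {\<xi>. \<forall>y. f y \<ge> f x + ereal (\<xi> \<bullet> (y - x))}"

text \<open>The resolvent \<open>(I + \<partial>\<psi>)\<^sup>-\<^sup>1\<close>, which is single-valued with full domain
  if \<open>\<psi>\<close> is closed, proper and convex.\<close>

definition prox :: "('a::real_inner \<Rightarrow> ereal) \<Rightarrow> 'a \<Rightarrow> 'a" where
  "prox \<psi> z = (THE p. \<exists>\<xi>\<in>subdiff \<psi> p. z = p + \<xi>)"

section \<open>Gradients\<close>

definition grad :: "('a::real_inner \<Rightarrow> real) \<Rightarrow> 'a \<Rightarrow> 'a" where
  "grad f x = (THE D. GDERIV f x :> D)"

definition grad_u :: "('u::real_inner \<times> 'v \<Rightarrow> real) \<Rightarrow> 'u \<Rightarrow> 'v \<Rightarrow> 'u" where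
  "grad_u \<phi> u v = grad (\<lambda>u'. \<phi> (u', v)) u"

definition grad_v :: "('u \<times> 'v::real_inner \<Rightarrow> real) \<Rightarrow> 'u \<Rightarrow> 'v \<Rightarrow> 'v" where
  "grad_v \<phi> u v = grad (\<lambda>v'. \<phi> (u, v')) v"

definition composite_smooth ::
  "('u::euclidean_space \<Rightarrow> ereal) \<Rightarrow> ('v::euclidean_space \<Rightarrow> ereal) \<Rightarrow> ('u \<times> 'v \<Rightarrow> real) \<Rightarrow>
   real \<Rightarrow> real \<Rightarrow> real \<Rightarrow> real \<Rightarrow> bool" where
  "composite_smooth f g \<phi> Luu Luv Lvu Lvv \<longleftrightarrow>
     closed_proper_convex f \<and> closed_proper_convex g \<and>
     \<phi> differentiable_on UNIV \<and> continuous_on UNIV (grad \<phi>) \<and>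
     Luu > 0 \<and> Luv > 0 \<and> Lvu > 0 \<and> Lvv > 0 \<and>
     (\<forall>u u' v v'. norm (grad_u \<phi> u v - grad_u \<phi> u' v') \<le> Luu * norm (u - u') + Luv * norm (v - v')) \<and>
     (\<forall>u u' v v'. norm (grad_v \<phi> u v - grad_v \<phi> u' v') \<le> Lvu * norm (u - u') + Lvv * norm (v - v'))"

section \<open>Operators and the weak MVI condition\<close>

definition gra :: "('a \<Rightarrow> 'b set) \<Rightarrow> ('a \<times> 'b) set" where
  "gra M = {(x, w). w \<in> M x}"

definition zeros :: "('a \<Rightarrow> 'b::zero set) \<Rightarrow> 'a set" where
  "zeros M = {x. 0 \<in> M x}"

definition weak_mvi_solutions :: "real \<Rightarrow> ('a::real_inner \<Rightarrow> 'a set) \<Rightarrow> 'a set" where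
  "weak_mvi_solutions \<rho> M =
     {xs \<in> zeros M. \<forall>(x, w)\<in>gra M. (x - xs) \<bullet> w \<ge> - (\<rho> / 2) * (norm w)\<^sup>2}"

definition weak_mvi :: "real \<Rightarrow> ('a::real_inner \<Rightarrow> 'a set) \<Rightarrow> bool" where
  "weak_mvi \<rho> M \<longleftrightarrow> weak_mvi_solutions \<rho> M \<noteq> {}"

definition saddle_op ::
  "('u::real_inner \<Rightarrow> ereal) \<Rightarrow> ('v::real_inner \<Rightarrow> ereal) \<Rightarrow> ('u \<times> 'v \<Rightarrow> real) \<Rightarrow>
   'u \<times> 'v \<Rightarrow> ('u \<times> 'v) set" where
  "saddle_op f g \<phi> = (\<lambda>(u, v).
     {(grad_u \<phi> u v + s, - grad_v \<phi> u v + t) | s t. s \<in> subdiff f u \<and> t \<in> subdiff g v})"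

section \<open>The Bregman distance and the method\<close>

definition bregman :: "('a::real_inner \<Rightarrow> real) \<Rightarrow> 'a \<Rightarrow> 'a \<Rightarrow> real" where
  "bregman h x y = h x - h y - grad h y \<bullet> (x - y)"

definition href :: "('u::real_inner \<times> 'v::real_inner \<Rightarrow> real) \<Rightarrow> real \<Rightarrow> 'u \<times> 'v \<Rightarrow> real" where
  "href \<phi> \<tau> = (\<lambda>(u, v). 1 / (2 * \<tau>) * ((norm u)\<^sup>2 + (norm v)\<^sup>2) - \<phi> (u, v))"

text \<open>One iteration of SA-MGDA with the exact maximization oracle (\<open>J = \<infinity>\<close>). The ascent step uses
  the new \<open>u'\<close> in \<open>\<phi> (u', w)\<close> but the old point in the gradient. For the step sizes considered, the
  maximized function is \<open>-\<infinity>\<close> outside the domain of \<open>g\<close> and strongly concave, so that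
  its maximizer exists and is unique.\<close>

definition sa_mgda_step ::
  "('u::real_inner \<Rightarrow> ereal) \<Rightarrow> ('v::real_inner \<Rightarrow> ereal) \<Rightarrow> ('u \<times> 'v \<Rightarrow> real) \<Rightarrow> real \<Rightarrow>
   'u \<times> 'v \<Rightarrow> 'u \<times> 'v" where
  "sa_mgda_step f g \<phi> \<tau> = (\<lambda>(u, v).
     let u' = prox (\<lambda>y. ereal \<tau> * f y) (u - \<tau> *\<^sub>R grad_u \<phi> u v);
         v' = arg_max
                (\<lambda>w. ereal (2 * \<phi> (u', w) - 1 / (2 * \<tau>) * (norm (w - (v - \<tau> *\<^sub>R grad_v \<phi> u v)))\<^sup>2) - g w)
                (\<lambda>w. True)
     in (u', v'))"

end

theory Submission
  imports Defs
begin

text \<open>Write \<open>h = href \<phi> \<tau>\<close>, \<open>\<Lambda> = 1 / \<tau> + L\<close> and let \<open>D\<close> be the Bregman distance of \<open>h\<close>. The method is a Bregman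
  proximal point method in disguise: the optimality conditions of the proximal descent step and of
  the exact maximization together say that
  \<open>w\<^sub>k = \<nabla>h x\<^sub>k - \<nabla>h x\<^sub>k\<^sub>+\<^sub>1\<close> lies in \<open>M x\<^sub>k\<^sub>+\<^sub>1\<close> (\<open>sa_mgda_step_inclusion\<close>). The factor 2 in front of
  \<open>\<phi> (u', w)\<close> in the maximization is what makes this work in the \<open>v\<close>-block: one of the two copies of
  \<open>\<nabla>\<^sub>v\<phi>\<close> at the new point goes into \<open>M\<close> and the other into \<open>\<nabla>h\<close>.

  Since \<open>\<nabla>\<phi>\<close> is \<open>L\<close>-Lipschitz, \<open>D x y\<close> lies between \<open>(1/\<tau> - L)/2\<close> and \<open>\<Lambda>/2\<close> times \<open>\<parallel>x - y\<parallel>\<^sup>2\<close>, where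
  \<open>1/\<tau> > L\<close>. The upper bound and the nonnegativity of \<open>D\<close> give the cocoercivity inequality
  \<open>\<parallel>\<nabla>h x - \<nabla>h y\<parallel>\<^sup>2 \<le> 2 \<Lambda> D x y\<close> (\<open>bregman_cocoercive\<close>), which bounds the residual \<open>w\<^sub>k\<close> by
  \<open>D x\<^sub>k\<^sub>+\<^sub>1 x\<^sub>k\<close>. Inserting it into the weak MVI inequality at \<open>(x\<^sub>k\<^sub>+\<^sub>1, w\<^sub>k)\<close>, rewritten by the three-point
  identity, yields
  \<open>D x\<^sub>* x\<^sub>k\<^sub>+\<^sub>1 + (1 - \<rho>\<Lambda>) D x\<^sub>k\<^sub>+\<^sub>1 x\<^sub>k \<le> D x\<^sub>* x\<^sub>k\<close> (\<open>bregman_descent\<close>), and the lower bound on \<open>\<tau>\<close> says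
  exactly that \<open>\<rho>\<Lambda> < 1\<close>. Summation gives the rate and \<open>w\<^sub>k \<rightarrow> 0\<close>, and then closedness of the graph
  of \<open>M\<close> identifies the limit points. If every zero satisfies the weak MVI inequality, then \<open>D l x\<^sub>k\<close> is
  decreasing for each limit point \<open>l\<close> and tends to 0 along a subsequence, hence along the whole sequence.

  The optimality conditions hold for the point that \<open>prox\<close> or \<open>arg_max\<close> denotes only if the defining
  problem has a solution, which for \<open>prox\<close> must also be unique. Existence is proved by compactness of
  the sublevel sets of a closed proper convex function plus a strongly convex quadratic bound
  (\<open>closed_proper_convex_plus_coercive_attains_min\<close>).\<close>

section \<open>Gradients and the quadratic bounds given by a Lipschitz gradient\<close>

lemma grad_eqI:
  assumes "GDERIV F x :> D"
  shows "grad F x = D"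
  unfolding grad_def
proof (rule the_equality)
  show "GDERIV F x :> D" by fact
  fix D' assume "GDERIV F x :> D'"
  then have "(\<lambda>h. h \<bullet> D') = (\<lambda>h. h \<bullet> D)"
    using assms unfolding gderiv_def by (rule has_derivative_unique)
  then have "\<forall>h. h \<bullet> D' = h \<bullet> D" by meson
  then show "D' = D" using vector_eq_ldot by blast
qed

lemma differentiable_imp_GDERIV_grad:
  fixes F :: "'a::euclidean_space \<Rightarrow> real"
  assumes "F differentiable (at x)"
  shows "GDERIV F x :> grad F x"
proof -
  obtain F' where F': "(F has_derivative F') (at x)"
    using assms differentiable_def by blast
  \<comment> \<open>Riesz representation: a linear functional is the inner product with its adjoint at 1.\<close>
  have "linear F'" using F' has_derivative_linear by blast
  then have "F' = (\<lambda>h. h \<bullet> adjoint F' 1)"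
    using adjoint_works[of F' _ 1] by auto
  with F' have "GDERIV F x :> adjoint F' 1" unfolding gderiv_def by simp
  then show ?thesis using grad_eqI by metis
qed

lemma GDERIV_Pair_partial:
  fixes \<phi> :: "'u::real_inner \<times> 'v::real_inner \<Rightarrow> real"
  assumes "GDERIV \<phi> (u, v) :> D"
  shows GDERIV_partial_fst: "GDERIV (\<lambda>u'. \<phi> (u', v)) u :> fst D"
    and GDERIV_partial_snd: "GDERIV (\<lambda>v'. \<phi> (u, v')) v :> snd D"
proof -
  have D: "(\<phi> has_derivative (\<lambda>h. h \<bullet> D)) (at (u, v))" using assms unfolding gderiv_def .
  have "((\<lambda>u'. \<phi> (u', v)) has_derivative (\<lambda>h. (h, 0) \<bullet> D)) (at u)"
    by (rule has_derivative_compose[where g = \<phi> and f = "\<lambda>u'. (u', v)", OF _ D])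
       (auto intro!: derivative_eq_intros)
  then show "GDERIV (\<lambda>u'. \<phi> (u', v)) u :> fst D" unfolding gderiv_def by (simp add: inner_prod_def)
  have "((\<lambda>v'. \<phi> (u, v')) has_derivative (\<lambda>h. (0, h) \<bullet> D)) (at v)"
    by (rule has_derivative_compose[where g = \<phi> and f = "\<lambda>v'. (u, v')", OF _ D])
       (auto intro!: derivative_eq_intros)
  then show "GDERIV (\<lambda>v'. \<phi> (u, v')) v :> snd D" unfolding gderiv_def by (simp add: inner_prod_def)
qed

text \<open>Along the segment from \<open>y\<close> to \<open>x\<close> the derivative of \<open>F\<close> exceeds its initial value by at most
  \<open>K t \<parallel>x - y\<parallel>\<^sup>2\<close>, so \<open>F\<close> minus the quadratic with exactly this derivative is nonincreasing.\<close>

lemma Lipschitz_gradient_upper_bound: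
  fixes F :: "'a::real_inner \<Rightarrow> real"
  assumes F: "\<And>z. GDERIV F z :> G z"
    and lip: "\<And>z z'. norm (G z - G z') \<le> K * norm (z - z')"
  shows "F x - F y - G y \<bullet> (x - y) \<le> K / 2 * (norm (x - y))\<^sup>2"
proof -
  define d where "d = x - y"
  define \<psi> where "\<psi> t = F (y + t *\<^sub>R d) - t * (G y \<bullet> d) - K / 2 * t\<^sup>2 * (norm d)\<^sup>2" for t :: real
  have deriv: "DERIV \<psi> t :> (G (y + t *\<^sub>R d) - G y) \<bullet> d - K * t * (norm d)\<^sup>2" for t
  proof -
    have "((\<lambda>t. F (y + t *\<^sub>R d)) has_derivative (\<lambda>s. (s *\<^sub>R d) \<bullet> G (y + t *\<^sub>R d))) (at t)"
      by (rule has_derivative_compose[where g = F and f = "\<lambda>t. y + t *\<^sub>R d", OF _ F[unfolded gderiv_def]])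
         (auto intro!: derivative_eq_intros)
    then have "DERIV (\<lambda>t. F (y + t *\<^sub>R d)) t :> G (y + t *\<^sub>R d) \<bullet> d"
      by (rule has_derivative_imp_has_field_derivative) (simp add: inner_commute)
    then show ?thesis unfolding \<psi>_def
      by (auto intro!: derivative_eq_intros simp: inner_diff_left algebra_simps)
  qed
  have "\<psi> 1 \<le> \<psi> 0"
  proof (rule DERIV_nonpos_imp_nonincreasing[of 0 1 \<psi>])
    fix t :: real assume t: "0 \<le> t" "t \<le> 1"
    have "(G (y + t *\<^sub>R d) - G y) \<bullet> d \<le> norm (G (y + t *\<^sub>R d) - G y) * norm d"
      by (rule norm_cauchy_schwarz)
    also have "\<dots> \<le> (K * norm (t *\<^sub>R d)) * norm d"
      using lip[of "y + t *\<^sub>R d" y] by (intro mult_right_mono) auto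
    also have "\<dots> = K * t * (norm d)\<^sup>2" using t by (simp add: power2_eq_square)
    finally show "\<exists>z. DERIV \<psi> t :> z \<and> z \<le> 0" using deriv by force
  qed simp
  then show ?thesis unfolding \<psi>_def d_def by simp
qed

lemma Lipschitz_gradient_quadratic_bound:
  fixes F :: "'a::real_inner \<Rightarrow> real"
  assumes F: "\<And>z. GDERIV F z :> G z"
    and lip: "\<And>z z'. norm (G z - G z') \<le> K * norm (z - z')"
  shows "\<bar>F x - F y - G y \<bullet> (x - y)\<bar> \<le> K / 2 * (norm (x - y))\<^sup>2"
proof -
  have "GDERIV (\<lambda>z. - F z) z :> - G z" for z by (rule GDERIV_minus[OF F])
  moreover have "norm (- G z - - G z') \<le> K * norm (z - z')" for z z'
    using lip[of z z'] by (simp add: norm_minus_commute)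
  ultimately have "- F x - - F y - - G y \<bullet> (x - y) \<le> K / 2 * (norm (x - y))\<^sup>2"
    by (rule Lipschitz_gradient_upper_bound)
  moreover have "F x - F y - G y \<bullet> (x - y) \<le> K / 2 * (norm (x - y))\<^sup>2"
    using F lip by (rule Lipschitz_gradient_upper_bound)
  ultimately show ?thesis unfolding abs_le_iff by simp
qed

lemma GDERIV_half_norm_square:
  "GDERIV (\<lambda>w. 1 / (2 * \<tau>) * (norm (w - c))\<^sup>2) w :> (1 / \<tau>) *\<^sub>R (w - c)"
proof -
  have "((\<lambda>w. (w - c) \<bullet> (w - c)) has_derivative (\<lambda>h. (w - c) \<bullet> h + h \<bullet> (w - c))) (at w)"
    by (auto intro!: derivative_eq_intros)
  from has_derivative_mult_right[OF this, of "1 / (2 * \<tau>)"] show ?thesis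
    unfolding gderiv_def power2_norm_eq_inner by (rule has_derivative_eq_rhs) (simp add: fun_eq_iff inner_commute)
qed

section \<open>Extended-valued convex functions\<close>

text \<open>A point strictly below the graph is separated from the closed convex epigraph by a hyperplane. This
  hyperplane is not vertical, because the point lies directly below a point of the epigraph, so it is
  the graph of an affine function.\<close>

lemma closed_proper_convex_affine_minorant:
  assumes "closed_proper_convex f"
  obtains a b where "\<And>y r. f y \<le> ereal r \<Longrightarrow> b + a \<bullet> y \<le> r"
proof -
  let ?E = "ereal_epigraph f"
  obtain x0 where "f x0 \<noteq> \<infinity>" "f x0 \<noteq> -\<infinity>"
    using assms unfolding closed_proper_convex_def by blast
  then obtain r0 where r0: "f x0 = ereal r0" by (cases "f x0") auto
  have "convex ?E" "closed ?E" "(x0, r0 - 1) \<notin> ?E"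
    using assms r0 by (auto simp: closed_proper_convex_def ereal_epigraph_def)
  then obtain n c where n: "n \<bullet> (x0, r0 - 1) < c" "\<forall>z\<in>?E. c < n \<bullet> z"
    using separating_hyperplane_closed_point by metis
  obtain \<alpha> \<beta> where ab: "n = (\<alpha>, \<beta>)" by fastforce
  have "c < n \<bullet> (x0, r0)" using n(2) r0 by (auto simp: ereal_epigraph_def)
  then have pos: "\<beta> > 0" using n(1) ab by (simp add: inner_prod_def algebra_simps)
  have "c / \<beta> + (- (1 / \<beta>) *\<^sub>R \<alpha>) \<bullet> y \<le> r" if "f y \<le> ereal r" for y r
  proof -
    have "c < \<alpha> \<bullet> y + \<beta> * r" using n(2) that ab by (force simp: ereal_epigraph_def inner_prod_def)
    then show ?thesis using pos by (simp add: field_simps)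
  qed
  then show thesis using that by blast
qed

text \<open>The affine minorant of \<open>f\<close> cannot compensate the quadratic growth of \<open>q\<close>. The minimization takes
  place in the epigraph, over pairs \<open>(w, r)\<close> with the continuous objective \<open>r + q w\<close>, instead of over
  \<open>w\<close> alone: closedness of the epigraph then plays the part of lower semicontinuity of \<open>f\<close>.\<close>

lemma closed_proper_convex_plus_coercive_attains_min:
  fixes f :: "'a::euclidean_space \<Rightarrow> ereal"
  assumes f: "closed_proper_convex f"
    and q: "continuous_on UNIV q" and "\<mu> > 0"
    and lower: "\<And>w. c + p \<bullet> w + \<mu> / 2 * (norm w)\<^sup>2 \<le> q w"
  obtains w where "\<And>y. f w + ereal (q w) \<le> f y + ereal (q y)"
proof -
  let ?E = "ereal_epigraph f"
  obtain a b where ab: "\<And>y r. f y \<le> ereal r \<Longrightarrow> b + a \<bullet> y \<le> r"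
    by (rule closed_proper_convex_affine_minorant[OF f]) (rule that, assumption)
  obtain x0 where "f x0 \<noteq> \<infinity>" "f x0 \<noteq> -\<infinity>"
    using f unfolding closed_proper_convex_def by blast
  then obtain r0 where r0: "f x0 = ereal r0" by (cases "f x0") auto
  define C where "C = r0 + q x0"
  define S where "S = ?E \<inter> {z. snd z + q (fst z) \<le> C}"
  have cont: "continuous_on UNIV (\<lambda>z. snd z + q (fst z))"
    by (intro continuous_intros continuous_on_compose2[OF q]) auto
  have closedS: "closed S" unfolding S_def
    using f cont by (intro closed_Int closed_Collect_le) (auto simp: closed_proper_convex_def)
  define P where "P = norm (a + p)"
  define C' where "C' = C - b - c"
  define R where "R = 1 + 2 * (P + \<bar>C'\<bar>) / \<mu>"
  \<comment> \<open>On \<open>S\<close>, \<open>n = norm w\<close> satisfies \<open>n (\<mu> n / 2 - P) \<le> C'\<close>; \<open>R\<close> is chosen such that \<open>n > R\<close> makes both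
    \<open>n \<ge> 1\<close> and \<open>\<mu> n / 2 - P > \<bar>C'\<bar>\<close>. The bounds on \<open>r\<close> follow from those on \<open>w\<close>.\<close>
  have bound: "norm w \<le> R \<and> b - norm a * R \<le> r \<and> r \<le> C - c + norm p * R"
    if "(w, r) \<in> S" for w r
  proof -
    have r: "b + a \<bullet> w \<le> r" and rq: "r + q w \<le> C"
      using that ab by (auto simp: S_def ereal_epigraph_def)
    have "(a + p) \<bullet> w + \<mu> / 2 * (norm w)\<^sup>2 \<le> C'"
      using r rq lower[of w] by (simp add: C'_def inner_add_left)
    moreover have "- (P * norm w) \<le> (a + p) \<bullet> w"
      using Cauchy_Schwarz_ineq2[of "a + p" w] by (simp add: P_def)
    ultimately have quad: "norm w * (\<mu> / 2 * norm w - P) \<le> C'"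
      by (simp add: power2_eq_square algebra_simps)
    have nR: "norm w \<le> R"
    proof (rule ccontr)
      assume "\<not> norm w \<le> R"
      then have big: "norm w > R" by simp
      have "0 \<le> 2 * (P + \<bar>C'\<bar>) / \<mu>" using \<open>\<mu> > 0\<close> by (simp add: P_def)
      then have one: "1 \<le> norm w" using big by (simp add: R_def)
      have gap: "\<bar>C'\<bar> < \<mu> / 2 * norm w - P"
      proof -
        have "\<mu> / 2 * norm w > \<mu> / 2 * R" using big \<open>\<mu> > 0\<close> by simp
        also have "\<mu> / 2 * R = \<mu> / 2 + (P + \<bar>C'\<bar>)"
          using \<open>\<mu> > 0\<close> by (simp add: R_def ring_distribs add_divide_distrib)
        finally show ?thesis using \<open>\<mu> > 0\<close> by simp
      qed
      have "1 * (\<mu> / 2 * norm w - P) \<le> norm w * (\<mu> / 2 * norm w - P)"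
        using gap by (intro mult_right_mono one) linarith
      also have "\<dots> \<le> C'" by (rule quad)
      finally show False using gap by simp
    qed
    have "- (norm a * R) \<le> a \<bullet> w" "- (norm p * R) \<le> p \<bullet> w"
      using Cauchy_Schwarz_ineq2[of a w] Cauchy_Schwarz_ineq2[of p w]
        mult_left_mono[OF nR norm_ge_zero[of a]] mult_left_mono[OF nR norm_ge_zero[of p]]
      by linarith+
    moreover have "0 \<le> \<mu> / 2 * (norm w)\<^sup>2" using \<open>\<mu> > 0\<close> by simp
    ultimately show ?thesis using nR r rq lower[of w] by linarith
  qed
  have "S \<subseteq> cball 0 R \<times> {b - norm a * R .. C - c + norm p * R}"
    using bound by auto
  then have "bounded S"
    by (rule bounded_subset[rotated]) (intro bounded_Times bounded_cball bounded_closed_interval)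
  then have "compact S" using closedS compact_eq_bounded_closed by blast
  moreover have mem: "(x0, r0) \<in> S" using r0 by (simp add: S_def ereal_epigraph_def C_def)
  ultimately obtain z where z: "z \<in> S" "\<And>y. y \<in> S \<Longrightarrow> snd z + q (fst z) \<le> snd y + q (fst y)"
    using continuous_attains_inf[of S "\<lambda>z. snd z + q (fst z)"] continuous_on_subset[OF cont]
    by blast
  have "f (fst z) + ereal (q (fst z)) \<le> f y + ereal (q y)" for y
  proof (cases "f y")
    case (real r)
    have "snd z + q (fst z) \<le> r + q y"
    proof (cases "(y, r) \<in> S")
      case True then show ?thesis using z(2) by force
    next
      case False
      then have "C < r + q y" using real by (simp add: S_def ereal_epigraph_def)
      then show ?thesis using z(1) by (simp add: S_def)
    qed
    moreover have "f (fst z) \<le> ereal (snd z)" using z(1) by (auto simp: S_def ereal_epigraph_def)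
    ultimately show ?thesis using real by (cases "f (fst z)") auto
  next
    case MInf then show ?thesis using f by (auto simp: closed_proper_convex_def)
  qed simp
  then show thesis using that by blast
qed

lemma closed_proper_convex_segment:
  assumes "closed_proper_convex f" "f x = ereal a" "f y = ereal b" "0 \<le> t" "t \<le> 1"
  shows "f (x + t *\<^sub>R (y - x)) \<le> ereal (a + t * (b - a))"
proof -
  have "convex (ereal_epigraph f)" "(x, a) \<in> ereal_epigraph f" "(y, b) \<in> ereal_epigraph f"
    using assms by (auto simp: closed_proper_convex_def ereal_epigraph_def)
  then have "(1 - t) *\<^sub>R (x, a) + t *\<^sub>R (y, b) \<in> ereal_epigraph f"
    using assms(4,5) by (intro convexD) auto
  moreover have "(1 - t) *\<^sub>R (x, a) + t *\<^sub>R (y, b) = (x + t *\<^sub>R (y - x), a + t * (b - a))"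
    by (simp add: algebra_simps)
  ultimately show ?thesis by (simp add: ereal_epigraph_def)
qed

text \<open>Moving from the minimizer \<open>w\<close> towards \<open>y\<close> by a fraction \<open>t\<close> raises \<open>f\<close> by at most \<open>t (f y - f w)\<close>, by
  convexity, and raises \<open>q\<close> by \<open>t\<close> times a difference quotient that tends to \<open>G \<bullet> (y - w)\<close>. The sum of
  the two is nonnegative; the limit \<open>t \<rightarrow> 0\<close> is the subgradient inequality.\<close>

lemma minimizer_imp_subgradient:
  fixes f :: "'a::euclidean_space \<Rightarrow> ereal"
  assumes f: "closed_proper_convex f"
    and q: "GDERIV q w :> G"
    and min: "\<And>y. f w + ereal (q w) \<le> f y + ereal (q y)"
  shows "- G \<in> subdiff f w"
proof -
  obtain x0 where "f x0 \<noteq> \<infinity>" and proper: "\<And>y. f y \<noteq> -\<infinity>"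
    using f unfolding closed_proper_convex_def by blast
  then have "f w \<noteq> \<infinity>" using min[of x0] by auto
  then obtain a where a: "f w = ereal a" using proper[of w] by (cases "f w") auto
  have "f w + ereal ((- G) \<bullet> (y - w)) \<le> f y" for y
  proof (cases "f y")
    case (real b)
    have "((\<lambda>t. q (w + t *\<^sub>R (y - w))) has_derivative (\<lambda>s. (s *\<^sub>R (y - w)) \<bullet> G)) (at 0)"
      by (rule has_derivative_compose[where g = q and f = "\<lambda>t. w + t *\<^sub>R (y - w)"])
         (use q in \<open>auto intro!: derivative_eq_intros simp: gderiv_def\<close>)
    then have "DERIV (\<lambda>t. q (w + t *\<^sub>R (y - w))) 0 :> G \<bullet> (y - w)"
      by (rule has_derivative_imp_has_field_derivative) (simp add: inner_commute)
    then have "((\<lambda>t. (q (w + t *\<^sub>R (y - w)) - q w) / t) \<longlongrightarrow> G \<bullet> (y - w)) (at 0)"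
      by (simp add: DERIV_def)
    then have lim: "((\<lambda>t. (q (w + t *\<^sub>R (y - w)) - q w) / t) \<longlongrightarrow> G \<bullet> (y - w)) (at_right 0)"
      by (rule filterlim_mono) (auto simp: at_le)
    have "a - b \<le> (q (w + t *\<^sub>R (y - w)) - q w) / t" if t: "0 < t" "t < 1" for t
    proof -
      have "ereal (a + q w) \<le> f (w + t *\<^sub>R (y - w)) + ereal (q (w + t *\<^sub>R (y - w)))"
        using min[of "w + t *\<^sub>R (y - w)"] a by simp
      also have "\<dots> \<le> ereal (a + t * (b - a)) + ereal (q (w + t *\<^sub>R (y - w)))"
        using closed_proper_convex_segment[OF f a real] t by (intro add_right_mono) auto
      finally have "t * (a - b) \<le> q (w + t *\<^sub>R (y - w)) - q w" by (simp add: algebra_simps)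
      then show ?thesis using t by (simp add: field_simps)
    qed
    then have "\<forall>\<^sub>F t in at_right 0. a - b \<le> (q (w + t *\<^sub>R (y - w)) - q w) / t"
      unfolding eventually_at_right_field by (intro exI[of _ 1]) auto
    then have "a - b \<le> G \<bullet> (y - w)"
      using tendsto_lowerbound[OF lim] by simp
    then show ?thesis using a real by simp
  qed (use proper in auto)
  then show ?thesis by (simp add: subdiff_def)
qed

lemma subdiff_imp_finite:
  assumes "closed_proper_convex f" "\<xi> \<in> subdiff f x"
  obtains a where "f x = ereal a"
proof -
  obtain x0 where "f x0 \<noteq> \<infinity>" "f x \<noteq> -\<infinity>"
    using assms(1) unfolding closed_proper_convex_def by blast
  moreover have "f x + ereal (\<xi> \<bullet> (x0 - x)) \<le> f x0" using assms(2) by (simp add: subdiff_def)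
  ultimately show thesis using that by (cases "f x") auto
qed

lemma subdiff_monotone:
  assumes f: "closed_proper_convex f" and "\<xi> \<in> subdiff f x" "\<eta> \<in> subdiff f y"
  shows "0 \<le> (\<xi> - \<eta>) \<bullet> (x - y)"
proof -
  obtain a where a: "f x = ereal a" using subdiff_imp_finite[OF f assms(2)] by blast
  obtain b where b: "f y = ereal b" using subdiff_imp_finite[OF f assms(3)] by blast
  have "f x + ereal (\<xi> \<bullet> (y - x)) \<le> f y" "f y + ereal (\<eta> \<bullet> (x - y)) \<le> f x"
    using assms by (auto simp: subdiff_def)
  then show ?thesis using a b by (simp add: inner_diff algebra_simps)
qed

text \<open>For fixed \<open>y\<close> with finite value, the subgradient inequality at \<open>x n\<close> says that
  \<open>(x n, f y - \<xi> n \<bullet> (y - x n))\<close> is in the epigraph of \<open>f\<close>, which is closed.\<close>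

lemma subdiff_closed_graph:
  fixes f :: "'a::euclidean_space \<Rightarrow> ereal"
  assumes f: "closed_proper_convex f"
    and mem: "\<And>n::nat. \<xi> n \<in> subdiff f (x n)"
    and lims: "\<xi> \<longlonglongrightarrow> \<xi>'" "x \<longlonglongrightarrow> x'"
  shows "\<xi>' \<in> subdiff f x'"
proof -
  have "f x' + ereal (\<xi>' \<bullet> (y - x')) \<le> f y" for y
  proof (cases "f y")
    case (real b)
    have "(x n, b - \<xi> n \<bullet> (y - x n)) \<in> ereal_epigraph f" for n
    proof -
      obtain a where a: "f (x n) = ereal a" using subdiff_imp_finite[OF f mem] by blast
      have "f (x n) + ereal (\<xi> n \<bullet> (y - x n)) \<le> f y" using mem by (simp add: subdiff_def)
      then show ?thesis using a real by (simp add: ereal_epigraph_def)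
    qed
    moreover have "(\<lambda>n. (x n, b - \<xi> n \<bullet> (y - x n))) \<longlonglongrightarrow> (x', b - \<xi>' \<bullet> (y - x'))"
      by (intro tendsto_intros lims)
    moreover have "closed (ereal_epigraph f)" using f by (simp add: closed_proper_convex_def)
    ultimately have "(x', b - \<xi>' \<bullet> (y - x')) \<in> ereal_epigraph f"
      by (metis (no_types, lifting) closed_sequentially)
    then show ?thesis using real by (cases "f x'") (auto simp: ereal_epigraph_def)
  qed (use f in \<open>auto simp: closed_proper_convex_def\<close>)
  then show ?thesis by (simp add: subdiff_def)
qed

lemma subdiff_scale:
  assumes "\<tau> > 0"
  shows "\<xi> \<in> subdiff (\<lambda>y. ereal \<tau> * f y) x \<longleftrightarrow> (1 / \<tau>) *\<^sub>R \<xi> \<in> subdiff f x"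
proof -
  have "ereal \<tau> * f x + ereal (\<xi> \<bullet> (y - x)) \<le> ereal \<tau> * f y \<longleftrightarrow>
        f x + ereal (((1 / \<tau>) *\<^sub>R \<xi>) \<bullet> (y - x)) \<le> f y" for y
    using assms by (cases "f x"; cases "f y") (auto simp: field_simps)
  then show ?thesis by (simp add: subdiff_def)
qed

text \<open>The function \<open>prox\<close> is a definite description, so both existence and uniqueness are needed: a
  minimizer of \<open>f\<close> plus the quadratic \<open>\<parallel>w - z\<parallel>\<^sup>2 / (2\<tau>)\<close> satisfies the inclusion, and two points with the
  inclusion coincide by monotonicity of the subdifferential.\<close>

lemma prox_inclusion:
  fixes f :: "'a::euclidean_space \<Rightarrow> ereal" and z :: 'a
  assumes f: "closed_proper_convex f" and \<tau>: "\<tau> > 0"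
  defines "p \<equiv> prox (\<lambda>y. ereal \<tau> * f y) z"
  shows "(1 / \<tau>) *\<^sub>R (z - p) \<in> subdiff f p"
proof -
  let ?Q = "\<lambda>p. \<exists>\<xi>\<in>subdiff (\<lambda>y. ereal \<tau> * f y) p. z = p + \<xi>"
  have Q: "?Q p \<longleftrightarrow> (1 / \<tau>) *\<^sub>R (z - p) \<in> subdiff f p" for p
  proof -
    have "?Q p \<longleftrightarrow> z - p \<in> subdiff (\<lambda>y. ereal \<tau> * f y) p"
      by (metis add_diff_cancel_left' add.commute diff_add_cancel)
    then show ?thesis using subdiff_scale[OF \<tau>] by blast
  qed
  define q where "q w = 1 / (2 * \<tau>) * (norm (w - z))\<^sup>2" for w
  have lower: "(norm z)\<^sup>2 / (2 * \<tau>) + (- (1 / \<tau>) *\<^sub>R z) \<bullet> w + (1 / \<tau>) / 2 * (norm w)\<^sup>2 \<le> q w" for w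
    using \<tau> by (simp add: q_def power2_norm_eq_inner inner_diff inner_commute field_simps)
  have "continuous_on UNIV q" unfolding q_def by (intro continuous_intros)
  then obtain w where w: "\<And>y. f w + ereal (q w) \<le> f y + ereal (q y)"
    using closed_proper_convex_plus_coercive_attains_min[OF f _ _ lower] \<tau> by auto
  have "GDERIV q w :> (1 / \<tau>) *\<^sub>R (w - z)" unfolding q_def by (rule GDERIV_half_norm_square)
  then have "- ((1 / \<tau>) *\<^sub>R (w - z)) \<in> subdiff f w"
    using w by (intro minimizer_imp_subgradient[OF f])
  then have ex: "?Q w" unfolding Q by (simp add: algebra_simps)
  have "?Q p" unfolding p_def prox_def
  proof (rule theI[of ?Q, OF ex])
    fix p' assume "?Q p'"
    then have "0 \<le> ((1 / \<tau>) *\<^sub>R (z - p') - (1 / \<tau>) *\<^sub>R (z - w)) \<bullet> (p' - w)"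
      using ex unfolding Q by (rule subdiff_monotone[OF f])
    also have "\<dots> = - (1 / \<tau>) * (norm (p' - w))\<^sup>2"
      by (simp add: power2_norm_eq_inner inner_diff inner_commute algebra_simps)
    finally show "p' = w" using \<tau> by (simp add: divide_le_0_iff)
  qed
  then show ?thesis unfolding Q .
qed

section \<open>Bregman proximal iterations\<close>

lemma bregman_three_points:
  "(y - z) \<bullet> (grad h x - grad h y) = bregman h z x - bregman h z y - bregman h y x"
  by (simp add: bregman_def inner_diff inner_commute algebra_simps)

text \<open>The convergence analysis depends on \<open>h\<close> only through two-sided quadratic bounds of its Bregman
  distance, and on the method only through the inclusion that makes \<open>x (Suc k)\<close> a value of the Bregman
  resolvent \<open>(\<nabla>h + M)\<^sup>-\<^sup>1 \<circ> \<nabla>h\<close>.\<close>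

locale bregman_proximal_iteration =
  fixes h :: "'a::euclidean_space \<Rightarrow> real" and M :: "'a \<Rightarrow> 'a set" and x :: "nat \<Rightarrow> 'a"
    and \<mu> \<Lambda> \<rho> :: real
  assumes \<mu>_pos: "0 < \<mu>" and \<Lambda>_pos: "0 < \<Lambda>" and \<rho>_nonneg: "0 \<le> \<rho>" and \<rho>\<Lambda>: "\<rho> * \<Lambda> < 1"
    and bregman_lower: "\<And>y z. \<mu> / 2 * (norm (y - z))\<^sup>2 \<le> bregman h y z"
    and bregman_upper: "\<And>y z. bregman h y z \<le> \<Lambda> / 2 * (norm (y - z))\<^sup>2"
    and inclusion: "\<And>k. grad h (x k) - grad h (x (Suc k)) \<in> M (x (Suc k))"
begin

lemma bregman_nonneg: "0 \<le> bregman h y z"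
proof -
  have "0 \<le> \<mu> / 2 * (norm (y - z))\<^sup>2" using \<mu>_pos by simp
  also have "\<dots> \<le> bregman h y z" by (rule bregman_lower)
  finally show ?thesis .
qed

text \<open>The Bregman distance to \<open>z\<close> is nonnegative, in particular at the point \<open>y'\<close> reached from \<open>y\<close> by a
  gradient step of length \<open>1 / \<Lambda>\<close>. By the quadratic upper bound this step decreases
  the distance to \<open>z\<close> by at least the left-hand side.\<close>

lemma bregman_cocoercive: "(norm (grad h y - grad h z))\<^sup>2 / (2 * \<Lambda>) \<le> bregman h y z"
proof -
  define d where "d = grad h y - grad h z"
  define y' where "y' = y - (1 / \<Lambda>) *\<^sub>R d"
  have "bregman h y' z = bregman h y z + bregman h y' y + d \<bullet> (y' - y)"
    by (simp add: bregman_def d_def inner_diff algebra_simps)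
  moreover have "d \<bullet> (y' - y) = - (norm d)\<^sup>2 / \<Lambda>"
    by (simp add: y'_def power2_norm_eq_inner)
  moreover have "bregman h y' y \<le> (norm d)\<^sup>2 / (2 * \<Lambda>)"
    using bregman_upper[of y' y] \<Lambda>_pos
    by (simp add: y'_def power2_eq_square field_simps)
  moreover have "0 \<le> bregman h y' z" by (rule bregman_nonneg)
  ultimately show ?thesis unfolding d_def[symmetric] by (simp add: field_simps)
qed

text \<open>The three-point identity turns the weak MVI inequality at \<open>x (Suc k)\<close> into this estimate with an
  error \<open>\<rho>/2 \<parallel>w\<parallel>\<^sup>2\<close>, and by cocoercivity the error is at most \<open>\<rho> \<Lambda>\<close> times the distance of consecutive
  iterates.\<close>

lemma bregman_descent:
  assumes "xs \<in> weak_mvi_solutions \<rho> M"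
  shows "bregman h xs (x (Suc k)) + (1 - \<rho> * \<Lambda>) * bregman h (x (Suc k)) (x k) \<le> bregman h xs (x k)"
proof -
  define w where "w = grad h (x k) - grad h (x (Suc k))"
  have "- (\<rho> / 2) * (norm w)\<^sup>2 \<le> (x (Suc k) - xs) \<bullet> w"
    using assms inclusion[of k] unfolding weak_mvi_solutions_def gra_def w_def by auto
  also have "\<dots> = bregman h xs (x k) - bregman h xs (x (Suc k)) - bregman h (x (Suc k)) (x k)"
    unfolding w_def by (rule bregman_three_points)
  finally have 1: "- (\<rho> / 2) * (norm w)\<^sup>2 \<le> \<dots>" .
  have "(norm w)\<^sup>2 / (2 * \<Lambda>) \<le> bregman h (x (Suc k)) (x k)"
    using bregman_cocoercive[of "x (Suc k)" "x k"] by (simp add: w_def norm_minus_commute)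
  then have "\<rho> * \<Lambda> * ((norm w)\<^sup>2 / (2 * \<Lambda>)) \<le> \<rho> * \<Lambda> * bregman h (x (Suc k)) (x k)"
    using \<rho>_nonneg \<Lambda>_pos by (intro mult_left_mono) auto
  then have "\<rho> / 2 * (norm w)\<^sup>2 \<le> \<rho> * \<Lambda> * bregman h (x (Suc k)) (x k)"
    using \<Lambda>_pos by (simp add: field_simps)
  with 1 show ?thesis by (simp add: algebra_simps)
qed

lemma bregman_decseq:
  assumes "xs \<in> weak_mvi_solutions \<rho> M"
  shows "decseq (\<lambda>k. bregman h xs (x k))"
proof (rule decseq_SucI)
  fix k
  have "0 \<le> (1 - \<rho> * \<Lambda>) * bregman h (x (Suc k)) (x k)"
    using \<rho>\<Lambda> bregman_nonneg by simp
  then show "bregman h xs (x (Suc k)) \<le> bregman h xs (x k)"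
    using bregman_descent[OF assms, of k] by linarith
qed

lemma sum_bregman_le:
  assumes "xs \<in> weak_mvi_solutions \<rho> M"
  shows "(1 - \<rho> * \<Lambda>) * (\<Sum>i<k. bregman h (x (Suc i)) (x i)) \<le> bregman h xs (x 0)"
proof -
  have "bregman h xs (x k) + (1 - \<rho> * \<Lambda>) * (\<Sum>i<k. bregman h (x (Suc i)) (x i)) \<le> bregman h xs (x 0)"
  proof (induction k)
    case (Suc k)
    then show ?case using bregman_descent[OF assms, of k] by (simp add: distrib_left)
  qed simp
  then show ?thesis using bregman_nonneg[of xs "x k"] by linarith
qed

text \<open>The minimum is at most the average of the telescoping sum.\<close>

lemma min_bregman_rate:
  assumes "xs \<in> weak_mvi_solutions \<rho> M" and "k \<ge> 1"
  shows "(MIN i\<in>{1..k}. bregman h (x i) (x (i - 1))) \<le> bregman h xs (x 0) / ((1 - \<rho> * \<Lambda>) * real k)"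
proof -
  let ?m = "MIN i\<in>{1..k}. bregman h (x i) (x (i - 1))"
  have "?m \<le> bregman h (x (Suc i)) (x i)" if "i < k" for i
    using that by (intro Min_le) (auto intro!: image_eqI[of _ _ "Suc i"])
  then have "real k * ?m \<le> (\<Sum>i<k. bregman h (x (Suc i)) (x i))"
    using sum_bounded_below[of "{..<k}" ?m "\<lambda>i. bregman h (x (Suc i)) (x i)"] by auto
  then have "(1 - \<rho> * \<Lambda>) * (real k * ?m) \<le> (1 - \<rho> * \<Lambda>) * (\<Sum>i<k. bregman h (x (Suc i)) (x i))"
    using \<rho>\<Lambda> by (intro mult_left_mono) auto
  also have "\<dots> \<le> bregman h xs (x 0)" by (rule sum_bregman_le[OF assms(1)])
  finally show ?thesis using \<rho>\<Lambda> assms(2) by (simp add: pos_le_divide_eq mult_ac)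
qed

lemma residual_tendsto_zero:
  assumes "weak_mvi \<rho> M"
  shows "(\<lambda>k. grad h (x k) - grad h (x (Suc k))) \<longlonglongrightarrow> 0"
proof -
  obtain xs where xs: "xs \<in> weak_mvi_solutions \<rho> M" using assms by (auto simp: weak_mvi_def)
  have "(\<Sum>i<k. bregman h (x (Suc i)) (x i)) \<le> bregman h xs (x 0) / (1 - \<rho> * \<Lambda>)" for k
    using sum_bregman_le[OF xs, of k] \<rho>\<Lambda> by (simp add: pos_le_divide_eq mult.commute)
  then have "summable (\<lambda>i. bregman h (x (Suc i)) (x i))"
    by (intro summableI_nonneg_bounded bregman_nonneg)
  then have lim: "(\<lambda>i. sqrt (2 * \<Lambda> * bregman h (x (Suc i)) (x i))) \<longlonglongrightarrow> sqrt (2 * \<Lambda> * 0)"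
    by (intro tendsto_intros summable_LIMSEQ_zero)
  have "norm (grad h (x i) - grad h (x (Suc i))) \<le> sqrt (2 * \<Lambda> * bregman h (x (Suc i)) (x i))" for i
    using bregman_cocoercive[of "x (Suc i)" "x i"] \<Lambda>_pos
    by (intro real_le_rsqrt) (simp add: norm_minus_commute field_simps)
  then show ?thesis
    by (intro Lim_null_comparison[OF _ lim[simplified]]) auto
qed

lemma limit_points_are_zeros:
  assumes "weak_mvi \<rho> M" and cl: "closed (gra M)"
    and r: "strict_mono r" "(x \<circ> r) \<longlonglongrightarrow> l"
  shows "l \<in> zeros M"
proof -
  \<comment> \<open>Only iterates of positive index carry an inclusion. Dropping the first term of the subsequence
    makes all indices positive, and \<open>s\<close> lists their predecessors.\<close>
  define s where "s n = r (Suc n) - 1" for n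
  have s: "Suc (s n) = r (Suc n)" for n
    using seq_suble[OF r(1), of "Suc n"] by (simp add: s_def)
  have "strict_mono s"
    using r(1) s by (smt (verit) Suc_less_eq strict_mono_Suc_iff)
  then have "(\<lambda>n. grad h (x (s n)) - grad h (x (Suc (s n)))) \<longlonglongrightarrow> 0"
    using LIMSEQ_subseq_LIMSEQ[OF residual_tendsto_zero[OF assms(1)]] by (simp add: o_def)
  moreover have "(\<lambda>n. x (Suc (s n))) \<longlonglongrightarrow> l"
    using LIMSEQ_Suc[OF r(2)] by (simp add: s o_def)
  ultimately have lim: "(\<lambda>n. (x (Suc (s n)), grad h (x (s n)) - grad h (x (Suc (s n))))) \<longlonglongrightarrow> (l, 0)"
    by (intro tendsto_intros)
  have "(x (Suc (s n)), grad h (x (s n)) - grad h (x (Suc (s n)))) \<in> gra M" for n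
    using inclusion by (simp add: gra_def)
  then have "(l, 0) \<in> gra M" using lim by (rule closed_sequentially[OF cl])
  then show ?thesis by (simp add: gra_def zeros_def)
qed

text \<open>By monotonicity of the distance to one solution the sequence is bounded and has a limit point \<open>l\<close>. As
  \<open>l\<close> is a zero, it is itself a weak MVI solution by \<open>eq\<close>, so the distance to \<open>l\<close> is monotone as well;
  by the quadratic upper bound it vanishes along a subsequence, so its limit is 0, and the quadratic
  lower bound turns this into convergence in norm.\<close>

lemma converges_to_solution:
  assumes mvi: "weak_mvi \<rho> M" and cl: "closed (gra M)"
    and eq: "weak_mvi_solutions \<rho> M = zeros M"
  shows "\<exists>xs\<in>weak_mvi_solutions \<rho> M. x \<longlonglongrightarrow> xs"
proof -
  obtain xs where xs: "xs \<in> weak_mvi_solutions \<rho> M" using mvi by (auto simp: weak_mvi_def)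
  have dist_le: "dist (x k) y \<le> sqrt (2 / \<mu> * bregman h y (x k))" for y k
    using bregman_lower[of y "x k"] \<mu>_pos
    by (intro real_le_rsqrt) (simp add: dist_norm norm_minus_commute field_simps)
  have "dist (x k) xs \<le> sqrt (2 / \<mu> * bregman h xs (x 0))" for k
  proof -
    have "bregman h xs (x k) \<le> bregman h xs (x 0)"
      using decseqD[OF bregman_decseq[OF xs], of 0 k] by simp
    then have "sqrt (2 / \<mu> * bregman h xs (x k)) \<le> sqrt (2 / \<mu> * bregman h xs (x 0))"
      using \<mu>_pos by (intro real_sqrt_le_mono mult_left_mono) auto
    then show ?thesis using dist_le[of k xs] by linarith
  qed
  then have "bounded (range x)" unfolding bounded_any_center[of _ xs] by (auto simp: dist_commute)
  then obtain l r where r: "strict_mono r" "(x \<circ> r) \<longlonglongrightarrow> l"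
    using bounded_imp_convergent_subsequence by blast
  have l: "l \<in> weak_mvi_solutions \<rho> M"
    unfolding eq using limit_points_are_zeros[OF mvi cl r] .
  have "(\<lambda>n. \<Lambda> / 2 * (norm (l - (x \<circ> r) n))\<^sup>2) \<longlonglongrightarrow> \<Lambda> / 2 * (norm (l - l))\<^sup>2"
    by (intro tendsto_intros r)
  then have up: "(\<lambda>n. \<Lambda> / 2 * (norm (l - x (r n)))\<^sup>2) \<longlonglongrightarrow> 0" by simp
  have sub: "(\<lambda>n. bregman h l (x (r n))) \<longlonglongrightarrow> 0"
    by (intro real_tendsto_sandwich[OF _ _ tendsto_const up] always_eventually allI
        bregman_nonneg bregman_upper)
  obtain D where D: "(\<lambda>k. bregman h l (x k)) \<longlonglongrightarrow> D"
    by (rule decseq_convergent[OF bregman_decseq[OF l], of 0]) (use bregman_nonneg in blast, rule that)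
  then have "(\<lambda>n. bregman h l (x (r n))) \<longlonglongrightarrow> D"
    using LIMSEQ_subseq_LIMSEQ[OF D r(1)] by (simp add: o_def)
  then have "D = 0" using sub LIMSEQ_unique by blast
  then have "(\<lambda>k. sqrt (2 / \<mu> * bregman h l (x k))) \<longlonglongrightarrow> sqrt (2 / \<mu> * 0)"
    using D by (intro tendsto_intros) auto
  then have "(\<lambda>k. dist (x k) l) \<longlonglongrightarrow> 0"
    using dist_le by (intro Lim_null_comparison[where f = "\<lambda>k. dist (x k) l"]) auto
  then have "x \<longlonglongrightarrow> l" by (rule tendsto_dist_iff[THEN iffD2])
  with l show ?thesis by blast
qed

end

section \<open>The saddle operator and the SA-MGDA step\<close>

lemma composite_smooth_gradients:
  assumes "composite_smooth f g \<phi> Luu Luv Lvu Lvv"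
  shows composite_smooth_GDERIV: "GDERIV \<phi> z :> grad \<phi> z"
    and composite_smooth_grad_u: "grad_u \<phi> u v = fst (grad \<phi> (u, v))"
    and composite_smooth_grad_v: "grad_v \<phi> u v = snd (grad \<phi> (u, v))"
proof -
  have D: "GDERIV \<phi> z :> grad \<phi> z" for z
  proof (rule differentiable_imp_GDERIV_grad)
    have "\<phi> differentiable_on UNIV" using assms unfolding composite_smooth_def by blast
    then show "\<phi> differentiable (at z)" unfolding differentiable_on_def by blast
  qed
  then show "GDERIV \<phi> z :> grad \<phi> z" .
  show "grad_u \<phi> u v = fst (grad \<phi> (u, v))"
    unfolding grad_u_def by (rule grad_eqI[OF GDERIV_partial_fst[OF D]])
  show "grad_v \<phi> u v = snd (grad \<phi> (u, v))"
    unfolding grad_v_def by (rule grad_eqI[OF GDERIV_partial_snd[OF D]])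
qed

lemma saddle_op_mem_iff:
  "w \<in> saddle_op f g \<phi> (u, v) \<longleftrightarrow>
     fst w - grad_u \<phi> u v \<in> subdiff f u \<and> snd w + grad_v \<phi> u v \<in> subdiff g v"
proof
  assume "fst w - grad_u \<phi> u v \<in> subdiff f u \<and> snd w + grad_v \<phi> u v \<in> subdiff g v"
  then show "w \<in> saddle_op f g \<phi> (u, v)" unfolding saddle_op_def
    by (auto intro!: exI[of _ "fst w - grad_u \<phi> u v"] exI[of _ "snd w + grad_v \<phi> u v"] simp: prod_eq_iff)
qed (auto simp: saddle_op_def)

lemma saddle_op_closed_graph:
  assumes cs: "composite_smooth f g \<phi> Luu Luv Lvu Lvv"
  shows "closed (gra (saddle_op f g \<phi>))"
  unfolding closed_sequential_limits
proof (intro allI impI, elim conjE)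
  fix z and l assume z: "\<forall>n. z n \<in> gra (saddle_op f g \<phi>)" "z \<longlonglongrightarrow> l"
  have f: "closed_proper_convex f" and g: "closed_proper_convex g"
    and cont: "continuous_on UNIV (grad \<phi>)" using cs by (auto simp: composite_smooth_def)
  define G where "G n = grad \<phi> (fst (z n))" for n
  have "isCont (grad \<phi>) (fst l)" using cont continuous_on_eq_continuous_at[OF open_UNIV] by blast
  then have G: "G \<longlonglongrightarrow> grad \<phi> (fst l)" unfolding G_def
    by (rule isCont_tendsto_compose) (intro tendsto_intros z)
  have mem: "fst (snd p) - fst (grad \<phi> (fst p)) \<in> subdiff f (fst (fst p)) \<and>
       snd (snd p) + snd (grad \<phi> (fst p)) \<in> subdiff g (snd (fst p)) \<longleftrightarrow> p \<in> gra (saddle_op f g \<phi>)" for p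
    by (cases p; cases "fst p") (auto simp: gra_def saddle_op_mem_iff composite_smooth_grad_u[OF cs]
        composite_smooth_grad_v[OF cs])
  have z': "fst (snd (z n)) - fst (G n) \<in> subdiff f (fst (fst (z n)))"
       "snd (snd (z n)) + snd (G n) \<in> subdiff g (snd (fst (z n)))" for n
    using z(1) unfolding mem[symmetric] G_def by auto
  have "fst (snd l) - fst (grad \<phi> (fst l)) \<in> subdiff f (fst (fst l))"
    by (rule subdiff_closed_graph[OF f, where \<xi> = "\<lambda>n. fst (snd (z n)) - fst (G n)" and x = "\<lambda>n. fst (fst (z n))"])
       (rule z'(1), (intro tendsto_intros z(2) G)+)
  moreover have "snd (snd l) + snd (grad \<phi> (fst l)) \<in> subdiff g (snd (fst l))"
    by (rule subdiff_closed_graph[OF g, where \<xi> = "\<lambda>n. snd (snd (z n)) + snd (G n)" and x = "\<lambda>n. snd (fst (z n))"])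
       (rule z'(2), (intro tendsto_intros z(2) G)+)
  ultimately show "l \<in> gra (saddle_op f g \<phi>)" using mem by blast
qed

text \<open>The values of the operator are slices of its closed graph, hence closed, and a nonempty closed set in
  a Euclidean space has an element of least norm.\<close>

lemma saddle_op_min_norm:
  assumes cs: "composite_smooth f g \<phi> Luu Luv Lvu Lvv"
    and ne: "w \<in> saddle_op f g \<phi> z" and "c > 0"
  obtains s where "is_arg_min (\<lambda>w. (norm w)\<^sup>2 / c) (\<lambda>w. w \<in> saddle_op f g \<phi> z) s"
proof -
  have "closed ((\<lambda>w. (z, w)) -` gra (saddle_op f g \<phi>))"
    by (intro closed_vimage saddle_op_closed_graph[OF cs] continuous_intros)
  then have "closed (saddle_op f g \<phi> z)" by (simp add: gra_def vimage_def)
  then obtain s where s: "s \<in> saddle_op f g \<phi> z" "\<And>w. w \<in> saddle_op f g \<phi> z \<Longrightarrow> dist 0 s \<le> dist 0 w"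
    using distance_attains_inf[of "saddle_op f g \<phi> z" 0] ne by blast
  have "(norm s)\<^sup>2 / c \<le> (norm w)\<^sup>2 / c" if "w \<in> saddle_op f g \<phi> z" for w
    using s(2)[OF that] \<open>c > 0\<close> by (intro divide_right_mono power_mono) auto
  then show thesis using s(1) that[of s] by (force simp: is_arg_min_def not_less)
qed

lemma href_eq: "href \<phi> \<tau> = (\<lambda>z. 1 / (2 * \<tau>) * (norm (z - 0))\<^sup>2 - \<phi> z)"
proof
  fix z :: "'a \<times> 'b"
  show "href \<phi> \<tau> z = 1 / (2 * \<tau>) * (norm (z - 0))\<^sup>2 - \<phi> z"
    by (cases z) (simp add: href_def norm_Pair)
qed

lemma grad_href:
  assumes "GDERIV \<phi> z :> D"
  shows "grad (href \<phi> \<tau>) z = (1 / \<tau>) *\<^sub>R z - D"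
proof -
  have "GDERIV (href \<phi> \<tau>) z :> (1 / \<tau>) *\<^sub>R (z - 0) - D"
    unfolding href_eq by (rule GDERIV_diff[OF GDERIV_half_norm_square assms])
  then show ?thesis by (simp add: grad_eqI)
qed

lemma bregman_href:
  assumes "GDERIV \<phi> y :> D"
  shows "bregman (href \<phi> \<tau>) z y = 1 / (2 * \<tau>) * (norm (z - y))\<^sup>2 - (\<phi> z - \<phi> y - D \<bullet> (z - y))"
proof -
  define \<kappa> where "\<kappa> = 1 / (2 * \<tau>)"
  have "1 / \<tau> = 2 * \<kappa>" by (simp add: \<kappa>_def)
  then show ?thesis
    unfolding bregman_def grad_href[OF assms] unfolding href_eq \<kappa>_def[symmetric] power2_norm_eq_inner
    by (simp add: inner_diff inner_commute[of y z] algebra_simps)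
qed

text \<open>With the sign reversed the objective is \<open>g + q\<close>, where \<open>q\<close> has a quadratic lower bound of
  modulus \<open>1/\<tau> - 2 K > 0\<close>. So maximizers exist, hence \<open>arg_max\<close> denotes one, and the claim is its
  first-order optimality condition.\<close>

lemma sa_mgda_ascent_inclusion:
  fixes g :: "'v::euclidean_space \<Rightarrow> ereal" and \<eta> :: "'v \<Rightarrow> real" and c :: 'v
  assumes g: "closed_proper_convex g" and "\<tau> > 0"
    and \<eta>: "\<And>w. GDERIV \<eta> w :> G w"
    and lip: "\<And>w w'. norm (G w - G w') \<le> K * norm (w - w')"
    and K: "2 * K < 1 / \<tau>"
  defines "v' \<equiv> arg_max (\<lambda>w. ereal (2 * \<eta> w - 1 / (2 * \<tau>) * (norm (w - c))\<^sup>2) - g w) (\<lambda>w. True)"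
  shows "2 *\<^sub>R G v' - (1 / \<tau>) *\<^sub>R (v' - c) \<in> subdiff g v'"
proof -
  define q where "q w = 1 / (2 * \<tau>) * (norm (w - c))\<^sup>2 - (\<eta> w + \<eta> w)" for w
  have q: "GDERIV q w :> (1 / \<tau>) *\<^sub>R (w - c) - (G w + G w)" for w
    unfolding q_def by (intro GDERIV_diff GDERIV_add GDERIV_half_norm_square \<eta>)
  have "isCont q w" for w
    using q[of w] unfolding gderiv_def by (rule has_derivative_continuous)
  then have cont: "continuous_on UNIV q" using continuous_on_eq_continuous_at[OF open_UNIV] by blast
  have lower: "((norm c)\<^sup>2 / (2 * \<tau>) - 2 * \<eta> 0) + (- (1 / \<tau>) *\<^sub>R c - 2 *\<^sub>R G 0) \<bullet> w
      + (1 / \<tau> - 2 * K) / 2 * (norm w)\<^sup>2 \<le> q w" for w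
  proof -
    have "\<eta> w - \<eta> 0 - G 0 \<bullet> w \<le> K / 2 * (norm w)\<^sup>2"
      using Lipschitz_gradient_upper_bound[OF \<eta> lip, of w 0] by simp
    moreover have "1 / (2 * \<tau>) * (norm (w - c))\<^sup>2
        = (norm c)\<^sup>2 / (2 * \<tau>) + (- (1 / \<tau>) *\<^sub>R c) \<bullet> w + 1 / \<tau> / 2 * (norm w)\<^sup>2"
      using \<open>\<tau> > 0\<close> by (simp add: power2_norm_eq_inner inner_diff inner_commute field_simps)
    ultimately show ?thesis unfolding q_def by (simp add: inner_diff_left algebra_simps diff_divide_distrib)
  qed
  obtain w where w: "\<And>y. g w + ereal (q w) \<le> g y + ereal (q y)"
    by (rule closed_proper_convex_plus_coercive_attains_min[OF g cont _ lower]) (use K in simp, rule that)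
  let ?F = "\<lambda>w. ereal (2 * \<eta> w - 1 / (2 * \<tau>) * (norm (w - c))\<^sup>2) - g w"
  have F: "?F w = - (g w + ereal (q w))" for w
  proof (cases "g w")
    case MInf then show ?thesis using g unfolding closed_proper_convex_def by blast
  qed (simp_all add: q_def)
  have "is_arg_max ?F (\<lambda>w. True) w" using w unfolding F by (simp add: is_arg_max_def not_less)
  then have "is_arg_max ?F (\<lambda>w. True) v'" unfolding v'_def arg_max_def by (rule someI)
  then have "g v' + ereal (q v') \<le> g y + ereal (q y)" for y
    unfolding F by (simp add: is_arg_max_def not_less)
  then have "- ((1 / \<tau>) *\<^sub>R (v' - c) - (G v' + G v')) \<in> subdiff g v'"
    by (rule minimizer_imp_subgradient[OF g q])
  then show ?thesis by (simp add: scaleR_2)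
qed

lemma sa_mgda_step_inclusion:
  assumes cs: "composite_smooth f g \<phi> Luu Luv Lvu Lvv"
    and lip: "L-lipschitz_on UNIV (grad \<phi>)"
    and "\<tau> > 0" and \<tau>: "L + Lvv < 1 / \<tau>"
  defines "h \<equiv> href \<phi> \<tau>"
  shows "grad h z - grad h (sa_mgda_step f g \<phi> \<tau> z) \<in> saddle_op f g \<phi> (sa_mgda_step f g \<phi> \<tau> z)"
proof -
  have f: "closed_proper_convex f" and g: "closed_proper_convex g" using cs by (auto simp: composite_smooth_def)
  obtain u v where uv: "z = (u, v)" by fastforce
  define u' where "u' = prox (\<lambda>y. ereal \<tau> * f y) (u - \<tau> *\<^sub>R grad_u \<phi> u v)"
  define v' where "v' = arg_max
      (\<lambda>w. ereal (2 * \<phi> (u', w) - 1 / (2 * \<tau>) * (norm (w - (v - \<tau> *\<^sub>R grad_v \<phi> u v)))\<^sup>2) - g w)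
      (\<lambda>w. True)"
  have step: "sa_mgda_step f g \<phi> \<tau> z = (u', v')"
    by (simp add: sa_mgda_step_def uv Let_def u'_def v'_def)
  have fs: "(1 / \<tau>) *\<^sub>R (u - \<tau> *\<^sub>R grad_u \<phi> u v - u') \<in> subdiff f u'"
    unfolding u'_def by (rule prox_inclusion[OF f \<open>\<tau> > 0\<close>])
  have D: "GDERIV (\<lambda>w. \<phi> (u', w)) w :> grad_v \<phi> u' w" for w
    unfolding composite_smooth_grad_v[OF cs]
    by (rule GDERIV_partial_snd, rule composite_smooth_GDERIV[OF cs])
  \<comment> \<open>Both \<open>L\<close> and \<open>Lvv\<close> are Lipschitz constants of \<open>\<nabla>\<^sub>v\<phi> (u', \<cdot>)\<close>. They enter through their mean because
    the maximization involves \<open>2 \<phi>\<close>, and twice the mean is the quantity \<open>L + Lvv\<close> that \<open>\<tau>\<close> controls.\<close>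
  have lip_v: "norm (grad_v \<phi> u' w - grad_v \<phi> u' w') \<le> (L + Lvv) / 2 * norm (w - w')" for w w'
  proof -
    have "norm (grad_v \<phi> u' w - grad_v \<phi> u' w') \<le> Lvu * norm (u' - u') + Lvv * norm (w - w')"
      using cs unfolding composite_smooth_def by blast
    moreover have "norm (grad_v \<phi> u' w - grad_v \<phi> u' w') \<le> norm (grad \<phi> (u', w) - grad \<phi> (u', w'))"
      unfolding composite_smooth_grad_v[OF cs] snd_diff[symmetric]
      using norm_snd_le[of "snd (grad \<phi> (u', w) - grad \<phi> (u', w'))"] by (metis prod.collapse)
    moreover have "norm (grad \<phi> (u', w) - grad \<phi> (u', w')) \<le> L * norm (w - w')"
      using lipschitz_onD[OF lip, of "(u', w)" "(u', w')"] by (simp add: dist_norm norm_Pair)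
    ultimately show ?thesis by (simp add: algebra_simps)
  qed
  have gs: "2 *\<^sub>R grad_v \<phi> u' v' - (1 / \<tau>) *\<^sub>R (v' - (v - \<tau> *\<^sub>R grad_v \<phi> u v)) \<in> subdiff g v'"
    unfolding v'_def by (rule sa_mgda_ascent_inclusion[OF g \<open>\<tau> > 0\<close> D lip_v]) (use \<tau> in simp)
  have grad_h: "grad h y = (1 / \<tau>) *\<^sub>R y - grad \<phi> y" for y
    unfolding h_def by (rule grad_href, rule composite_smooth_GDERIV[OF cs])
  show ?thesis unfolding step saddle_op_mem_iff grad_h unfolding uv
    using fs gs \<open>\<tau> > 0\<close>
    by (simp add: composite_smooth_grad_u[OF cs] composite_smooth_grad_v[OF cs] algebra_simps scaleR_2)
qed

section \<open>Convergence of SA-MGDA\<close>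

theorem theorem5p1:
  fixes f :: "'u::euclidean_space \<Rightarrow> ereal"
    and g :: "'v::euclidean_space \<Rightarrow> ereal"
    and \<phi> :: "'u \<times> 'v \<Rightarrow> real"
    and Luu Luv Lvu Lvv L \<rho> \<tau> :: real
    and x :: "nat \<Rightarrow> 'u \<times> 'v"
  assumes "composite_smooth f g \<phi> Luu Luv Lvu Lvv"
    and "L > 0" and "L-lipschitz_on UNIV (grad \<phi>)"
    and "weak_mvi \<rho> (saddle_op f g \<phi>)"
    and "\<rho> \<in> {0..<1 / (2 * L + max Luu Lvv)}"
    and "\<tau> \<in> {\<rho> / (1 - \<rho> * L)<..<1 / (L + max Luu Lvv)}"
    and "\<And>k. x (Suc k) = sa_mgda_step f g \<phi> \<tau> (x k)"
  shows
    "(\<forall>k\<ge>1. \<forall>xs\<in>weak_mvi_solutions \<rho> (saddle_op f g \<phi>).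
       (\<exists>s. (\<forall>i\<in>{1..k}. is_arg_min (\<lambda>w. (norm w)\<^sup>2 / (2 * (1 / \<tau> + L)))
                            (\<lambda>w. w \<in> saddle_op f g \<phi> (x i)) (s i)) \<and>
            (MIN i\<in>{1..k}. (norm (s i))\<^sup>2 / (2 * (1 / \<tau> + L)))
              \<le> (MIN i\<in>{1..k}. bregman (href \<phi> \<tau>) (x i) (x (i - 1)))) \<and>
       (MIN i\<in>{1..k}. bregman (href \<phi> \<tau>) (x i) (x (i - 1)))
         \<le> bregman (href \<phi> \<tau>) xs (x 0) / ((1 - \<rho> * (1 / \<tau> + L)) * real k)) \<and>
     (\<forall>l. (\<exists>r. strict_mono r \<and> (x \<circ> r) \<longlonglongrightarrow> l) \<longrightarrow> l \<in> zeros (saddle_op f g \<phi>)) \<and>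
     (weak_mvi_solutions \<rho> (saddle_op f g \<phi>) = zeros (saddle_op f g \<phi>) \<longrightarrow>
       (\<exists>xs\<in>weak_mvi_solutions \<rho> (saddle_op f g \<phi>). x \<longlonglongrightarrow> xs))"
proof -
  let ?M = "saddle_op f g \<phi>" and ?h = "href \<phi> \<tau>"
  define \<Lambda> where "\<Lambda> = 1 / \<tau> + L"
  note cs = assms(1)
  have Lpos: "Luu > 0" "Lvv > 0" using cs by (auto simp: composite_smooth_def)
  have \<rho>: "0 \<le> \<rho>" "\<rho> * (2 * L + max Luu Lvv) < 1"
    using assms(2,5) Lpos by (auto simp: field_simps)
  have "\<rho> * L \<le> \<rho> * (2 * L + max Luu Lvv)"
    using \<rho>(1) assms(2) Lpos by (intro mult_left_mono) auto
  then have \<rho>L: "\<rho> * L < 1" using \<rho>(2) by linarith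
  have "0 \<le> \<rho> / (1 - \<rho> * L)" using \<rho>(1) \<rho>L by simp
  then have \<tau>: "\<tau> > 0" and \<tau>_lower: "\<rho> / (1 - \<rho> * L) < \<tau>" using assms(6) by auto
  have \<tau>_upper: "L + max Luu Lvv < 1 / \<tau>"
    using assms(2,6) Lpos \<tau> by (auto simp: field_simps)
  have "\<rho> < \<tau> * (1 - \<rho> * L)" using \<tau>_lower \<rho>L by (simp add: pos_divide_less_eq)
  then have \<rho>\<Lambda>: "\<rho> * \<Lambda> < 1" using \<tau> by (simp add: \<Lambda>_def field_simps)
  have \<Lambda>: "\<Lambda> > 0" using \<tau> assms(2) by (simp add: \<Lambda>_def add_pos_pos)
  have D: "GDERIV \<phi> z :> grad \<phi> z" for z by (rule composite_smooth_GDERIV[OF cs])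
  have quad: "\<bar>\<phi> y - \<phi> z - grad \<phi> z \<bullet> (y - z)\<bar> \<le> L / 2 * (norm (y - z))\<^sup>2" for y z
    using lipschitz_onD[OF assms(3)] by (intro Lipschitz_gradient_quadratic_bound D) (simp add: dist_norm)
  interpret bregman_proximal_iteration ?h ?M x "1 / \<tau> - L" \<Lambda> \<rho>
  proof
    fix y z
    show "(1 / \<tau> - L) / 2 * (norm (y - z))\<^sup>2 \<le> bregman ?h y z"
      "bregman ?h y z \<le> \<Lambda> / 2 * (norm (y - z))\<^sup>2"
      using quad[of y z] unfolding bregman_href[OF D] \<Lambda>_def abs_le_iff
      by (simp_all add: algebra_simps diff_divide_distrib add_divide_distrib)
  next
    fix k
    show "grad ?h (x k) - grad ?h (x (Suc k)) \<in> ?M (x (Suc k))"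
      unfolding assms(7) using \<tau>_upper by (intro sa_mgda_step_inclusion[OF cs assms(3) \<tau>]) auto
  qed (use \<tau>_upper Lpos \<Lambda> \<rho> \<rho>\<Lambda> in auto)
  have "\<exists>s. is_arg_min (\<lambda>w. (norm w)\<^sup>2 / (2 * \<Lambda>)) (\<lambda>w. w \<in> ?M (x (Suc i))) s" for i
    by (rule saddle_op_min_norm[OF cs inclusion[of i], of "2 * \<Lambda>"]) (use \<Lambda> in simp, blast)
  then obtain s' where s': "is_arg_min (\<lambda>w. (norm w)\<^sup>2 / (2 * \<Lambda>)) (\<lambda>w. w \<in> ?M (x (Suc i))) (s' i)" for i
    by metis
  \<comment> \<open>The starting point need not have a value of \<open>M\<close>, so minimal elements are chosen from index 1 on.\<close>
  define s where "s i = s' (i - 1)" for i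
  have s: "is_arg_min (\<lambda>w. (norm w)\<^sup>2 / (2 * \<Lambda>)) (\<lambda>w. w \<in> ?M (x (Suc i))) (s (Suc i))" for i
    using s' by (simp add: s_def)
  have s_le: "(norm (s (Suc i)))\<^sup>2 / (2 * \<Lambda>) \<le> bregman ?h (x (Suc i)) (x i)" for i
  proof -
    have "(norm (s (Suc i)))\<^sup>2 / (2 * \<Lambda>) \<le> (norm (grad ?h (x i) - grad ?h (x (Suc i))))\<^sup>2 / (2 * \<Lambda>)"
      using s[of i] inclusion[of i] unfolding is_arg_min_linorder by blast
    then show ?thesis using bregman_cocoercive[of "x (Suc i)" "x i"] by (simp add: norm_minus_commute)
  qed
  have residual: "\<exists>s. (\<forall>i\<in>{1..k}. is_arg_min (\<lambda>w. (norm w)\<^sup>2 / (2 * \<Lambda>)) (\<lambda>w. w \<in> ?M (x i)) (s i)) \<and>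
      (MIN i\<in>{1..k}. (norm (s i))\<^sup>2 / (2 * \<Lambda>)) \<le> (MIN i\<in>{1..k}. bregman ?h (x i) (x (i - 1)))"
    if "k \<ge> 1" for k
  proof (intro exI[of _ s] conjI ballI)
    fix i assume "i \<in> {1..k}"
    then show "is_arg_min (\<lambda>w. (norm w)\<^sup>2 / (2 * \<Lambda>)) (\<lambda>w. w \<in> ?M (x i)) (s i)"
      using s[of "i - 1"] by simp
  next
    have "(MIN i\<in>{1..k}. (norm (s i))\<^sup>2 / (2 * \<Lambda>)) \<le> bregman ?h (x i) (x (i - 1))" if "i \<in> {1..k}" for i
      using s_le[of "i - 1"] that by (intro order_trans[OF Min_le]) auto
    then show "(MIN i\<in>{1..k}. (norm (s i))\<^sup>2 / (2 * \<Lambda>)) \<le> (MIN i\<in>{1..k}. bregman ?h (x i) (x (i - 1)))"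
      using that by (subst Min_ge_iff) auto
  qed
  show ?thesis unfolding \<Lambda>_def[symmetric]
    using residual min_bregman_rate limit_points_are_zeros[OF assms(4) saddle_op_closed_graph[OF cs]]
      converges_to_solution[OF assms(4) saddle_op_closed_graph[OF cs]]
    by blast
qed

end
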